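(* Let $A \in \mathbb{R}^{n\times n}$. For real $k>0$ let $A_k = \exp(kA)$ be the matrix with entries $(A_k)_{ij} = e^{kA_{ij}}$, let $\mathscr{L}(A_k)$ be a Perron eigenvector of $A_k$, and let $\mathscr{P}_k = \frac{1}{k}\log(\mathscr{L}(A_k)) \in \mathbb{R}^n$ (logarithm taken entrywise), regarded as a point of $\mathbb{TP}^{n-1}$. Then, as $k \to \infty$, $\mathscr{P}_k$ lies asymptotically in the max-plus eigenspace $\sigma_{max+}(A)$; that is, $$\lim_{k\to\infty}\ \inf_{y \in \sigma_{max+}(A)\cap\mathbb{R}^n} \left( \max_{1\le i\le n} \big((\mathscr{P}_k)_i - y_i\big) - \min_{1\le i\le n} \big((\mathscr{P}_k)_i - y_i\big) \right) = 0 .$$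
   Context: For a square matrix $N$ with strictly positive real entries, the Perron eigenvalue $\rho(N)$ is its positive real eigenvalue of largest modulus, and the Perron eigenvector $\mathscr{L}(N)$ is the corresponding eigenvector with all entries positive; it is unique up to a positive scalar multiple. The max-plus semiring is $\mathbb{R}\cup\{-\infty\}$ with $a\oplus b = \max(a,b)$ and $a\odot b = a+b$. For $A\in\mathbb{R}^{n\times n}$ the max-plus eigenvalue $\lambda_{max+}(A)$ is the unique real number $\lambda$ for which there is a vector $x \in (\mathbb{R}\cup\{-\infty\})^n$, not all of whose entries are $-\infty$, with $\max_j (A_{ij}+x_j) = \lambda + x_i$ for all $i$. The eigenspace $\sigma_{max+}(A)$ is the set of all $x$ satisfying these equations with $\lambda = \lambda_{max+}(A)$. It is closed under adding a constant to all coordinates. Tropical projective space is $\mathbb{TP}^{n-1} = \mathbb{R}^n/\mathbb{R}(1,\dots,1)$, and $\max_i(x_i-y_i)-\min_i(x_i-y_i)$ is a metric on $\mathbb{TP}^{n-1}$ inducing its usual topology. Rescaling $\mathscr{L}(A_k)$ by a positive factor adds a constant to all coordinates of $\mathscr{P}_k$, so the point of $\mathbb{TP}^{n-1}$ is well defined. *)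

theory Defs
  imports "HOL-Analysis.Analysis"
begin

definition complex_eigenvalue :: "real^'n^'n \<Rightarrow> complex \<Rightarrow> bool" where
  "complex_eigenvalue N \<mu> \<longleftrightarrow>
     (\<exists>v::complex^'n. v \<noteq> 0 \<and> (\<chi> i j. complex_of_real (N $ i $ j)) *v v = \<mu> *s v)"

definition perron_eigenvalue :: "real^'n^'n \<Rightarrow> real \<Rightarrow> bool" where
  "perron_eigenvalue N \<rho> \<longleftrightarrow>
     \<rho> > 0 \<and> complex_eigenvalue N (complex_of_real \<rho>) \<and>
     (\<forall>\<mu>. complex_eigenvalue N \<mu> \<longrightarrow> cmod \<mu> \<le> \<rho>)"

definition perron_eigenvector :: "real^'n^'n \<Rightarrow> real^'n \<Rightarrow> bool" where
  "perron_eigenvector N v \<longleftrightarrow>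
     (\<forall>i. v $ i > 0) \<and> (\<exists>\<rho>. perron_eigenvalue N \<rho> \<and> N *v v = \<rho> *s v)"

text \<open>The max-plus semiring is the set of extended reals other than \<open>\<infinity>\<close>.\<close>

definition maxplus_vectors :: "(ereal^'n) set" where
  "maxplus_vectors = {x. \<forall>i. x $ i \<noteq> \<infinity>}"

definition maxplus_eigen_eq :: "real^'n^'n \<Rightarrow> real \<Rightarrow> ereal^'n \<Rightarrow> bool" where
  "maxplus_eigen_eq A l x \<longleftrightarrow>
     (\<forall>i. Max (range (\<lambda>j. ereal (A $ i $ j) + x $ j)) = ereal l + x $ i)"

definition maxplus_eigenvalue :: "real^'n^'n \<Rightarrow> real" where
  "maxplus_eigenvalue A =
     (THE l. \<exists>x\<in>maxplus_vectors. (\<exists>i. x $ i \<noteq> -\<infinity>) \<and> maxplus_eigen_eq A l x)"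

definition maxplus_eigenspace :: "real^'n^'n \<Rightarrow> (ereal^'n) set" where
  "maxplus_eigenspace A =
     {x \<in> maxplus_vectors. maxplus_eigen_eq A (maxplus_eigenvalue A) x}"

definition real_maxplus_eigenspace :: "real^'n^'n \<Rightarrow> (real^'n) set" where
  "real_maxplus_eigenspace A = {y. (\<chi> i. ereal (y $ i)) \<in> maxplus_eigenspace A}"

text \<open>The metric of tropical projective space, on representatives: it is invariant
  under adding a constant to all coordinates of either argument.\<close>

definition tp_dist :: "real^'n \<Rightarrow> real^'n \<Rightarrow> real" where
  "tp_dist x y = Max (range (\<lambda>i. x $ i - y $ i)) - Min (range (\<lambda>i. x $ i - y $ i))"

definition exp_matrix :: "real \<Rightarrow> real^'n^'n \<Rightarrow> real^'n^'n" where
  "exp_matrix k A = (\<chi> i j. exp (k * A $ i $ j))"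

definition scaled_log :: "real \<Rightarrow> real^'n \<Rightarrow> real^'n" where
  "scaled_log k v = (\<chi> i. ln (v $ i) / k)"

end

theory Submission
  imports Defs
begin

text \<open>
  Taking logarithms of the Perron equation and dividing by \<open>k\<close> turns it into the max-plus
  eigenvalue equation up to an error, because a sum of \<open>n\<close> positive terms lies between its
  largest term and \<open>n\<close> times that term. So \<open>P k = log (L k) / k\<close> is a max-plus eigenvector up
  to \<open>ln n / k\<close> (\<open>perron_near_eigenpair\<close>), and this error tends to \<open>0\<close>.

  Such near eigenvectors have a spread that is bounded in terms of \<open>A\<close>
  (\<open>near_eigenpair_spread\<close>), since every entry of \<open>A\<close> is finite. After subtracting a constant
  they stay in a compact set, together with their eigenvalues. If the distance
  to the eigenspace did not tend to \<open>0\<close>, a sequence of parameters tending to infinity would keep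
  it above some positive bound; a convergent subsequence has a limit that satisfies the equation
  exactly (\<open>near_eigenpair_limit\<close>), for some real eigenvalue. As the max-plus eigenvalue
  of a finite matrix is unique (\<open>near_eigenvalue_le\<close>), that limit lies in the eigenspace,
  and the distance to it tends to \<open>0\<close> along the subsequence, a contradiction.
  The argument also yields the existence of a real max-plus eigenvector.
\<close>

text \<open>The tolerance is one-sided because a sum of exponentials only errs upwards from its largest
  term. Stating the maximum as an upper bound that some term attains up to \<open>d\<close> keeps all later
  estimates linear; \<open>d = 0\<close> is the exact eigenvalue equation.\<close>

definition near_eigenpair :: "real^'n^'n \<Rightarrow> real \<Rightarrow> real \<Rightarrow> real^'n \<Rightarrow> bool" where
  "near_eigenpair A d l x \<longleftrightarrow>
     (\<forall>i. (\<forall>j. A $ i $ j + x $ j \<le> l + x $ i) \<and> (\<exists>j. l + x $ i \<le> A $ i $ j + x $ j + d))"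

lemma near_eigenpair_upper: "near_eigenpair A d l x \<Longrightarrow> A $ i $ j + x $ j \<le> l + x $ i"
  by (simp add: near_eigenpair_def)

lemma near_eigenpair_lower:
  assumes "near_eigenpair A d l x"
  obtains j where "l + x $ i \<le> A $ i $ j + x $ j + d"
  using assms by (auto simp: near_eigenpair_def)

lemma near_eigenpair_shift:
  "near_eigenpair A d l (\<chi> i. x $ i - c) \<longleftrightarrow> near_eigenpair A d l x"
  by (simp add: near_eigenpair_def algebra_simps)

section \<open>The max-plus eigenvalue equation\<close>

lemma maxplus_eigen_eq_real_iff:
  "maxplus_eigen_eq A l (\<chi> i. ereal (y $ i)) \<longleftrightarrow> near_eigenpair A 0 l y"
proof -
  have "Max (range (\<lambda>j. ereal (A $ i $ j) + ereal (y $ j))) = ereal l + ereal (y $ i) \<longleftrightarrow>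
      (\<forall>j. A $ i $ j + y $ j \<le> l + y $ i) \<and> (\<exists>j. l + y $ i \<le> A $ i $ j + y $ j)" for i
    by (subst Max_eq_iff) (auto intro: antisym)
  then show ?thesis
    by (simp add: maxplus_eigen_eq_def near_eigenpair_def)
qed

text \<open>One finite entry of \<open>x\<close> makes every maximum finite, because all entries of \<open>A\<close> are finite.\<close>

lemma maxplus_eigenvector_real:
  assumes x: "x \<in> maxplus_vectors" and fin: "x $ i0 \<noteq> -\<infinity>" and eq: "maxplus_eigen_eq A l x"
  obtains y where "x = (\<chi> i. ereal (y $ i))"
proof -
  have "x $ i \<noteq> -\<infinity>" for i
  proof
    assume inf: "x $ i = -\<infinity>"
    have "ereal (A $ i $ i0) + x $ i0 \<le> Max (range (\<lambda>j. ereal (A $ i $ j) + x $ j))"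
      by (rule Max_ge) auto
    also have "\<dots> = -\<infinity>"
      using eq inf by (simp add: maxplus_eigen_eq_def)
    finally show False
      using fin by (cases "x $ i0") auto
  qed
  then have "x = (\<chi> i. ereal ((\<chi> i. real_of_ereal (x $ i)) $ i))"
    using x by (auto simp: maxplus_vectors_def vec_eq_iff ereal_real)
  then show thesis
    by (rule that)
qed

text \<open>Translate \<open>y\<close> until it just dominates \<open>x\<close>. At a coordinate where the two then agree,
  monotonicity of the max-plus action compares the eigenvalues.\<close>

lemma near_eigenvalue_le:
  assumes x: "near_eigenpair A d l x" and y: "near_eigenpair A e m y"
  shows "l \<le> m + d"
proof -
  have "Max (range (\<lambda>i. x $ i - y $ i)) \<in> range (\<lambda>i. x $ i - y $ i)"
    by (rule Max_in) auto
  then obtain i where max: "Max (range (\<lambda>i. x $ i - y $ i)) = x $ i - y $ i"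
    by blast
  have i: "x $ j - y $ j \<le> x $ i - y $ i" for j
    unfolding max[symmetric] by (rule Max_ge) auto
  obtain j where "l + x $ i \<le> A $ i $ j + x $ j + d"
    using near_eigenpair_lower[OF x] .
  with i[of j] near_eigenpair_upper[OF y, of i j] show ?thesis
    by linarith
qed

lemma near_eigenpair_imp_eigenspace:
  assumes y: "near_eigenpair A 0 l y"
  shows "y \<in> real_maxplus_eigenspace A"
proof -
  have vec: "(\<chi> i. ereal (y $ i)) \<in> maxplus_vectors"
    by (simp add: maxplus_vectors_def)
  have eq: "maxplus_eigen_eq A l (\<chi> i. ereal (y $ i))"
    using y by (simp add: maxplus_eigen_eq_real_iff)
  have "maxplus_eigenvalue A = l"
    unfolding maxplus_eigenvalue_def
  proof (rule the_equality)
    show "\<exists>x\<in>maxplus_vectors. (\<exists>i. x $ i \<noteq> -\<infinity>) \<and> maxplus_eigen_eq A l x"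
      using vec eq by (intro bexI[of _ "\<chi> i. ereal (y $ i)"]) auto
  next
    fix m assume "\<exists>x\<in>maxplus_vectors. (\<exists>i. x $ i \<noteq> -\<infinity>) \<and> maxplus_eigen_eq A m x"
    then obtain z where "near_eigenpair A 0 m z"
      by (metis maxplus_eigenvector_real maxplus_eigen_eq_real_iff)
    then show "m = l"
      using near_eigenvalue_le[OF _ y] near_eigenvalue_le[OF y] by force
  qed
  then show ?thesis
    using vec eq by (simp add: real_maxplus_eigenspace_def maxplus_eigenspace_def)
qed

section \<open>Compactness of near eigenpairs\<close>

lemma near_eigenpair_spread:
  assumes x: "near_eigenpair A d l x" and B: "\<And>i j. \<bar>A $ i $ j\<bar> \<le> B"
  shows "\<bar>x $ i - x $ i'\<bar> \<le> 2 * B + d"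
proof -
  \<comment> \<open>Coordinate \<open>i\<close> is nearly determined by some \<open>j\<close>, which also bounds coordinate \<open>i'\<close> from below.\<close>
  have "x $ i - x $ i' \<le> 2 * B + d" for i i'
  proof -
    obtain j where "l + x $ i \<le> A $ i $ j + x $ j + d"
      using near_eigenpair_lower[OF x] .
    with near_eigenpair_upper[OF x, of i' j] B[of i j] B[of i' j] show ?thesis
      by linarith
  qed
  from this[of i i'] this[of i' i] show ?thesis
    by linarith
qed

lemma near_eigenvalue_bound:
  fixes A :: "real^'n^'n"
  assumes x: "near_eigenpair A d l x" and B: "\<And>i j. \<bar>A $ i $ j\<bar> \<le> B"
  shows "\<bar>l\<bar> \<le> 3 * B + 2 * d"
proof -
  fix i :: 'n
  obtain j where "l + x $ i \<le> A $ i $ j + x $ j + d"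
    using near_eigenpair_lower[OF x] .
  moreover from this have "0 \<le> d"
    using near_eigenpair_upper[OF x, of i j] by linarith
  moreover have "A $ i $ i \<le> l"
    using near_eigenpair_upper[OF x, of i i] by simp
  moreover have "- B \<le> A $ i $ i" "A $ i $ j \<le> B" "0 \<le> B"
    using B[of i i] B[of i j] by linarith+
  moreover have "x $ j - x $ i \<le> 2 * B + d"
    using near_eigenpair_spread[OF x B, of j i] by linarith
  ultimately show ?thesis
    unfolding abs_le_iff by linarith
qed

text \<open>The attained maximum survives the limit because there are only finitely many candidate
  terms: if each of them stayed below the limit value, all would eventually do so at once.\<close>

lemma near_eigenpair_limit:
  fixes x :: "nat \<Rightarrow> real^'n"
  assumes near: "\<And>m. near_eigenpair A (d m) (l m) (x m)"
    and d: "d \<longlonglongrightarrow> 0" and l: "l \<longlonglongrightarrow> l0" and x: "x \<longlonglongrightarrow> x0"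
  shows "near_eigenpair A 0 l0 x0"
  unfolding near_eigenpair_def
proof (intro allI conjI)
  fix i j
  have "(\<lambda>m. A $ i $ j + x m $ j) \<longlonglongrightarrow> A $ i $ j + x0 $ j"
    and "(\<lambda>m. l m + x m $ i) \<longlonglongrightarrow> l0 + x0 $ i"
    by (intro tendsto_intros l x)+
  then show "A $ i $ j + x0 $ j \<le> l0 + x0 $ i"
    by (rule LIMSEQ_le) (use near_eigenpair_upper[OF near] in blast)
next
  fix i
  show "\<exists>j. l0 + x0 $ i \<le> A $ i $ j + x0 $ j + 0"
  proof (rule ccontr)
    assume "\<not> ?thesis"
    then have less: "A $ i $ j + x0 $ j + 0 - (l0 + x0 $ i) < 0" for j
      by (simp add: not_le)
    have "\<forall>\<^sub>F m in sequentially. A $ i $ j + x m $ j + d m - (l m + x m $ i) < 0" for j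
      by (rule order_tendstoD(2)[OF _ less[of j]]) (intro tendsto_intros l x d)
    then have "\<forall>\<^sub>F m in sequentially. \<forall>j. A $ i $ j + x m $ j + d m - (l m + x m $ i) < 0"
      by (rule eventually_all_finite)
    then obtain m where "\<forall>j. A $ i $ j + x m $ j + d m - (l m + x m $ i) < 0"
      by (auto simp: eventually_sequentially)
    moreover obtain j where "l m + x m $ i \<le> A $ i $ j + x m $ j + d m"
      using near_eigenpair_lower[OF near] .
    ultimately show False
      by (metis diff_less_0_iff_less linorder_not_less)
  qed
qed

text \<open>The vectors themselves may drift to infinity along the direction of the constant vectors;
  the bound on the spread shows that this is the only way to escape, so subtracting constants
  \<open>c\<close> restores compactness.\<close>

lemma near_eigenpairs_subsequence:
  fixes x :: "nat \<Rightarrow> real^'n"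
  assumes near: "\<And>m. near_eigenpair A (d m) (l m) (x m)" and d: "d \<longlonglongrightarrow> 0"
  obtains r c y l0 where "strict_mono r" "near_eigenpair A 0 l0 y"
    "(\<lambda>m. \<chi> i. x (r m) $ i - c (r m)) \<longlonglongrightarrow> y"
proof -
  fix i0 :: 'n
  \<comment> \<open>Any normalisation of the additive constant works; here coordinate \<open>i0\<close> is made zero.\<close>
  define q where "q m = (\<chi> i. x m $ i - x m $ i0)" for m
  have q: "near_eigenpair A (d m) (l m) (q m)" for m
    unfolding q_def near_eigenpair_shift by (rule near)
  define B where "B = Max (range (\<lambda>(i, j). \<bar>A $ i $ j\<bar>))"
  have B: "\<bar>A $ i $ j\<bar> \<le> B" for i j
    unfolding B_def by (rule Max_ge) (auto intro: image_eqI[of _ _ "(i, j)"])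
  have "Bseq d"
    using d by (intro convergent_imp_Bseq convergentI)
  then obtain D where D: "\<And>m. \<bar>d m\<bar> \<le> D"
    by (auto simp: Bseq_def)
  have "\<bar>q m $ i\<bar> \<le> 2 * B + D" for m i
    using near_eigenpair_spread[OF near B, of m i i0] D[of m] by (simp add: q_def)
  then have "norm (q m) \<le> of_nat CARD('n) * (2 * B + D)" for m
    by (intro order_trans[OF norm_le_l1_cart] sum_bounded_above)
  then have "bounded (range q)"
    by (intro boundedI) auto
  moreover have "\<bar>l m\<bar> \<le> 3 * B + 2 * D" for m
    using near_eigenvalue_bound[OF near B, of m] D[of m] by linarith
  then have "bounded (range l)"
    by (intro boundedI) auto
  ultimately have "bounded (range q \<times> range l)"
    by (rule bounded_Times)
  then have "bounded (range (\<lambda>m. (q m, l m)))"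
    by (rule bounded_subset) auto
  then obtain y l0 r where r: "strict_mono r" and lim: "((\<lambda>m. (q m, l m)) \<circ> r) \<longlonglongrightarrow> (y, l0)"
    by (auto dest!: bounded_imp_convergent_subsequence)
  have qy: "(\<lambda>m. q (r m)) \<longlonglongrightarrow> y" and ll: "(\<lambda>m. l (r m)) \<longlonglongrightarrow> l0"
    using tendsto_fst[OF lim] tendsto_snd[OF lim] by (simp_all add: o_def)
  have "(\<lambda>m. d (r m)) \<longlonglongrightarrow> 0"
    using LIMSEQ_subseq_LIMSEQ[OF d r] by (simp add: o_def)
  from near_eigenpair_limit[OF q this ll qy] have "near_eigenpair A 0 l0 y" .
  with r show thesis
    using qy by (rule that[where c = "\<lambda>m. x m $ i0", folded q_def])
qed

section \<open>Perron eigenvectors and the projective metric\<close>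

lemma perron_near_eigenpair:
  fixes A :: "real^'n^'n"
  assumes k: "k > 0" and v: "perron_eigenvector (exp_matrix k A) v"
  obtains l where "near_eigenpair A (ln (real CARD('n)) / k) l (scaled_log k v)"
proof -
  from v obtain \<rho> where pos: "\<And>i. v $ i > 0" and \<rho>: "\<rho> > 0"
    and eig: "exp_matrix k A *v v = \<rho> *s v"
    by (auto simp: perron_eigenvector_def perron_eigenvalue_def)
  define n where "n = real CARD('n)"
  have n: "n > 0"
    by (simp add: n_def)
  define t where "t i j = exp (k * A $ i $ j) * v $ j" for i j
  have t: "t i j > 0" for i j
    using pos by (simp add: t_def)
  have sum: "(\<Sum>j\<in>UNIV. t i j) = \<rho> * v $ i" for i
    using arg_cong[OF eig, of "\<lambda>w. w $ i"]
    by (simp add: matrix_vector_mult_def exp_matrix_def t_def)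
  have ln_t: "ln (t i j) / k = A $ i $ j + scaled_log k v $ j" for i j
    using pos[of j] k by (simp add: t_def ln_mult scaled_log_def field_simps)
  have ln_v: "ln (\<rho> * v $ i) / k = ln \<rho> / k + scaled_log k v $ i" for i
    using pos[of i] \<rho> by (simp add: ln_mult scaled_log_def add_divide_distrib)
  have "near_eigenpair A (ln n / k) (ln \<rho> / k) (scaled_log k v)"
    unfolding near_eigenpair_def
  proof (intro allI conjI)
    fix i j
    have "t i j \<le> \<rho> * v $ i"
      unfolding sum[symmetric] using t by (intro member_le_sum) (auto intro: less_imp_le)
    then have "ln (t i j) / k \<le> ln (\<rho> * v $ i) / k"
      using t[of i j] k by (intro divide_right_mono) auto
    then show "A $ i $ j + scaled_log k v $ j \<le> ln \<rho> / k + scaled_log k v $ i"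
      by (simp add: ln_t ln_v)
  next
    fix i
    have "\<exists>j. \<rho> * v $ i \<le> n * t i j"
    proof (rule ccontr)
      assume "\<not> ?thesis"
      then have "t i j < \<rho> * v $ i / n" for j
        using n by (simp add: not_le field_simps)
      then have "(\<Sum>j\<in>UNIV. t i j) < (\<Sum>j\<in>(UNIV::'n set). \<rho> * v $ i / n)"
        by (intro sum_strict_mono) auto
      then show False
        using n by (simp add: sum n_def)
    qed
    then obtain j where j: "\<rho> * v $ i \<le> n * t i j" ..
    have "ln (\<rho> * v $ i) / k \<le> ln (n * t i j) / k"
      using j \<rho> pos[of i] n t[of i j] k by (intro divide_right_mono) auto
    also have "\<dots> = ln (t i j) / k + ln n / k"
      using n t[of i j] by (simp add: ln_mult add_divide_distrib)
    finally show "\<exists>j. ln \<rho> / k + scaled_log k v $ i \<le> A $ i $ j + scaled_log k v $ j + ln n / k"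
      by (auto simp: ln_t ln_v)
  qed
  then show thesis
    unfolding n_def by (rule that)
qed

lemma tp_dist_nonneg: "0 \<le> tp_dist x y"
proof -
  fix i
  have "Min (range (\<lambda>i. x $ i - y $ i)) \<le> x $ i - y $ i"
    and "x $ i - y $ i \<le> Max (range (\<lambda>i. x $ i - y $ i))"
    by (rule Min_le Max_ge; simp)+
  then show ?thesis
    by (simp add: tp_dist_def)
qed

lemma tp_dist_le_norm: "tp_dist x y \<le> 2 * norm ((\<chi> i. x $ i - c) - y)"
proof -
  let ?e = "norm ((\<chi> i. x $ i - c) - y)"
  have "\<bar>x $ i - c - y $ i\<bar> \<le> ?e" for i
    using component_le_norm_cart[of "(\<chi> i. x $ i - c) - y" i] by simp
  then have "x $ i - y $ i \<le> c + ?e \<and> c - ?e \<le> x $ i - y $ i" for i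
    by (smt (verit))
  then have "Max (range (\<lambda>i. x $ i - y $ i)) \<le> c + ?e" "c - ?e \<le> Min (range (\<lambda>i. x $ i - y $ i))"
    by auto
  then show ?thesis
    unfolding tp_dist_def by linarith
qed

section \<open>Convergence to the eigenspace\<close>

theorem proposition2p4p1:
  fixes A :: "real^'n^'n" and L :: "real \<Rightarrow> real^'n"
  assumes "\<And>k. k > 0 \<Longrightarrow> perron_eigenvector (exp_matrix k A) (L k)"
  shows "((\<lambda>k. INF y\<in>real_maxplus_eigenspace A. ereal (tp_dist (scaled_log k (L k)) y))
           \<longlongrightarrow> 0) at_top"
proof -
  define P where "P k = scaled_log k (L k)" for k
  define D where "D k = (INF y\<in>real_maxplus_eigenspace A. ereal (tp_dist (P k) y))" for k
  have "(D \<longlongrightarrow> 0) at_top"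
  proof (rule order_tendstoI)
    fix a :: ereal
    assume "a < 0"
    also have "0 \<le> D k" for k
      unfolding D_def by (rule INF_greatest) (simp add: tp_dist_nonneg)
    finally show "\<forall>\<^sub>F k in at_top. a < D k"
      by simp
  next
    fix a :: ereal
    assume a: "0 < a"
    show "\<forall>\<^sub>F k in at_top. D k < a"
    proof (rule ccontr)
      assume "\<not> ?thesis"
      then have "\<exists>k\<ge>real (Suc m). \<not> D k < a" for m
        unfolding eventually_at_top_linorder by blast
      then obtain k where k: "\<And>m. real (Suc m) \<le> k m" and far: "\<And>m. \<not> D (k m) < a"
        by metis
      have k_pos: "k m > 0" for m
        using k[of m] by simp
      have "\<exists>l. near_eigenpair A (ln (real CARD('n)) / k m) l (P (k m))" for m
        using perron_near_eigenpair[OF k_pos assms[OF k_pos]] unfolding P_def by metis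
      then obtain l where near: "\<And>m. near_eigenpair A (ln (real CARD('n)) / k m) (l m) (P (k m))"
        by metis
      have "filterlim k at_top sequentially"
        by (rule filterlim_at_top_mono[OF filterlim_real_sequentially])
          (intro always_eventually allI order_trans[OF _ k], simp)
      then have tol: "(\<lambda>m. ln (real CARD('n)) / k m) \<longlonglongrightarrow> 0"
        by (intro tendsto_divide_0[OF tendsto_const] filterlim_at_top_imp_at_infinity)
      obtain r c y l0
        where "strict_mono r" and y: "near_eigenpair A 0 l0 y"
          and lim: "(\<lambda>m. \<chi> i. P (k (r m)) $ i - c (r m)) \<longlonglongrightarrow> y"
        by (rule near_eigenpairs_subsequence[OF near tol])
      let ?e = "\<lambda>m. 2 * norm ((\<chi> i. P (k (r m)) $ i - c (r m)) - y)"
      have "?e \<longlonglongrightarrow> 2 * norm (y - y)"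
        by (intro tendsto_intros lim)
      then have "(\<lambda>m. ereal (?e m)) \<longlonglongrightarrow> 0"
        by (simp add: zero_ereal_def)
      from order_tendstoD(2)[OF this a] obtain m where m: "ereal (?e m) < a"
        by (auto simp: eventually_sequentially)
      have "D (k (r m)) \<le> ereal (tp_dist (P (k (r m))) y)"
        unfolding D_def by (rule INF_lower[OF near_eigenpair_imp_eigenspace[OF y]])
      also have "\<dots> \<le> ereal (?e m)"
        by (simp add: tp_dist_le_norm)
      finally show False
        using m far[of "r m"] by simp
    qed
  qed
  then show ?thesis
    by (simp add: D_def[abs_def] P_def)
qed

end
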